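(* Let $n\ge 1$, let $a,b,x,y$ belong to $\mathbb{C}_n^\perp\subset A_n$, and suppose that $a$ and $b$ are both $\mathbb{C}$-orthogonal to both $x$ and $y$. Then, in $A_{n+1}$, $$\{a,b\}\,\{x,y\}=\sqrt{2}\,\{ax,by\}.$$
   Context: The Cayley-Dickson algebras $A_n$ are real algebras with involution defined inductively: $A_0=\mathbb{R}$ with trivial conjugation, and $A_n=A_{n-1}\times A_{n-1}$ additively, with $(a,b)^*=(a^*,-b)$ and $(a,b)(c,d)=(ac-d^*b,\;da+bc^* )$. $A_{n-1}$ is viewed as the subalgebra $A_{n-1}\times 0$ of $A_n$. For $n\ge 1$ put $i_n=(0,1)\in A_n$, and let $\mathbb{C}_n$ be the $\mathbb{R}$-linear span of $1=(1,0)$ and $i_n$ (a subalgebra isomorphic to $\mathbb{C}$); left multiplication makes $A_n$ a $\mathbb{C}_n$-vector space. The real inner product is $\langle a,b\rangle_{\mathbb{R}}=\mathrm{Re}(ab^* )$, where $\mathrm{Re}(x)=\frac12(x+x^* )$. The Hermitian inner product $\langle a,b\rangle_{\mathbb{C}}$ is the orthogonal projection of $ab^*$ onto $\mathbb{C}_n$; $a,b$ are $\mathbb{C}$-orthogonal if $\langle a,b\rangle_{\mathbb{C}}=0$. $\mathbb{C}_n^\perp$ is the orthogonal complement of $\mathbb{C}_n$ in $A_n$. For $a,b\in\mathbb{C}_n^\perp$, $\{a,b\}$ denotes the element $\frac{1}{\sqrt2}\big(a+b,\;i_n(-a+b)\big)$ of $A_{n+1}$. (Under the stated hypotheses, $ax$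 and $by$ lie in $\mathbb{C}_n^\perp$.) *)

theory Defs
  imports Complex_Main
begin

text \<open>
  The Cayley-Dickson algebras all live in one type: \<open>CD a b\<close> is the pair \<open>(a, b)\<close> and the
  carrier of the \<open>n\<close>-th algebra is the set \<open>cd_alg n\<close> of the balanced trees of height \<open>n\<close>.
  Binary operations are only meaningful on two elements of the same \<open>cd_alg n\<close>; outside
  of this they are unspecified. In particular the type has no global zero or unit, and
  \<open>cd_alg n\<close> is not literally a subset of \<open>cd_alg (Suc n)\<close>: the scalar \<open>r\<close>
  is represented in \<open>cd_alg n\<close> by \<open>r *\<^sub>R one_A n\<close>.
\<close>

datatype cd = Scalar real | CD cd cd

primrec cd_alg :: "nat \<Rightarrow> cd set" where
  "cd_alg 0 = range Scalar"
| "cd_alg (Suc n) = {CD a b | a b. a \<in> cd_alg n \<and> b \<in> cd_alg n}"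

primrec zero_A :: "nat \<Rightarrow> cd" where
  "zero_A 0 = Scalar 0"
| "zero_A (Suc n) = CD (zero_A n) (zero_A n)"

primrec one_A :: "nat \<Rightarrow> cd" where
  "one_A 0 = Scalar 1"
| "one_A (Suc n) = CD (one_A n) (zero_A n)"

instantiation cd :: "{plus, uminus, minus, scaleR}"
begin

fun plus_cd :: "cd \<Rightarrow> cd \<Rightarrow> cd" where
  "plus_cd (Scalar r) (Scalar s) = Scalar (r + s)"
| "plus_cd (CD a b) (CD c d) = CD (plus_cd a c) (plus_cd b d)"

primrec uminus_cd :: "cd \<Rightarrow> cd" where
  "uminus_cd (Scalar r) = Scalar (- r)"
| "uminus_cd (CD a b) = CD (uminus_cd a) (uminus_cd b)"

definition minus_cd :: "cd \<Rightarrow> cd \<Rightarrow> cd" where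
  "minus_cd a b = a + (- b)"

primrec scaleR_cd :: "real \<Rightarrow> cd \<Rightarrow> cd" where
  "scaleR_cd t (Scalar r) = Scalar (t * r)"
| "scaleR_cd t (CD a b) = CD (scaleR_cd t a) (scaleR_cd t b)"

instance ..

end

primrec star :: "cd \<Rightarrow> cd" where
  "star (Scalar r) = Scalar r"
| "star (CD a b) = CD (star a) (- b)"

lemma size_uminus_cd [simp]: "size (- a :: cd) = size a"
  by (induction a) auto

lemma size_star [simp]: "size (star a) = size a"
  by (induction a) auto

instantiation cd :: times
begin

function (sequential) times_cd :: "cd \<Rightarrow> cd \<Rightarrow> cd" where
  "times_cd (Scalar r) (Scalar s) = Scalar (r * s)"
| "times_cd (CD a b) (CD c d) =
     CD (times_cd a c - times_cd (star d) b) (times_cd d a + times_cd b (star c))"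
  by pat_completeness auto
termination
  by (relation "measure (\<lambda>(a, b). size a + size b)") auto

instance ..

end

text \<open>The element \<open>(0, 1)\<close> of \<open>cd_alg n\<close>; only meaningful for \<open>n \<ge> 1\<close>.\<close>

definition ii :: "nat \<Rightarrow> cd" where
  "ii n = CD (zero_A (n - 1)) (one_A (n - 1))"

definition CC :: "nat \<Rightarrow> cd set" where
  "CC n = {r *\<^sub>R one_A n + s *\<^sub>R ii n | r s. True}"

definition re_part :: "cd \<Rightarrow> cd" where
  "re_part x = (1/2) *\<^sub>R (x + star x)"

text \<open>
  For \<open>x \<in> cd_alg n\<close> the element \<open>re_part x\<close> is a real multiple of the unit, so that the following is
  the real number \<open>Re (a b\<^sup>*)\<close>; see \<open>re_part_eq_scalar\<close> and \<open>rinner_spec\<close> below.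
\<close>

definition rinner :: "nat \<Rightarrow> cd \<Rightarrow> cd \<Rightarrow> real" where
  "rinner n a b = (THE r. r *\<^sub>R one_A n = re_part (a * star b))"

definition orth_compl :: "nat \<Rightarrow> cd set \<Rightarrow> cd set" where
  "orth_compl n V = {x \<in> cd_alg n. \<forall>v\<in>V. rinner n x v = 0}"

text \<open>The orthogonal projection of \<open>x \<in> cd_alg n\<close> onto a subspace \<open>V\<close> of \<open>cd_alg n\<close>.\<close>

definition orth_proj :: "nat \<Rightarrow> cd set \<Rightarrow> cd \<Rightarrow> cd" where
  "orth_proj n V x = (THE p. p \<in> V \<and> x - p \<in> orth_compl n V)"

definition hinner :: "nat \<Rightarrow> cd \<Rightarrow> cd \<Rightarrow> cd" where
  "hinner n a b = orth_proj n (CC n) (a * star b)"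

definition C_orthogonal :: "nat \<Rightarrow> cd \<Rightarrow> cd \<Rightarrow> bool" where
  "C_orthogonal n a b \<longleftrightarrow> hinner n a b = zero_A n"

definition CC_perp :: "nat \<Rightarrow> cd set" where
  "CC_perp n = orth_compl n (CC n)"

text \<open>For \<open>a\<close>, \<open>b\<close> in \<open>cd_alg n\<close> the following is the element \<open>{a, b}\<close> of \<open>cd_alg (Suc n)\<close>.\<close>

definition brace :: "nat \<Rightarrow> cd \<Rightarrow> cd \<Rightarrow> cd" where
  "brace n a b = (1 / sqrt 2) *\<^sub>R CD (a + b) (ii n * (- a + b))"

lemma zero_A_in [simp]: "zero_A n \<in> cd_alg n"
  by (induction n) auto

lemma one_A_in [simp]: "one_A n \<in> cd_alg n"
  by (induction n) auto

lemma uminus_in [simp]: "a \<in> cd_alg n \<Longrightarrow> - a \<in> cd_alg n"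
  by (induction n arbitrary: a) auto

lemma plus_in [simp]: "a \<in> cd_alg n \<Longrightarrow> b \<in> cd_alg n \<Longrightarrow> a + b \<in> cd_alg n"
  by (induction n arbitrary: a b) auto

lemma minus_in [simp]: "a \<in> cd_alg n \<Longrightarrow> b \<in> cd_alg n \<Longrightarrow> (a::cd) - b \<in> cd_alg n"
  by (simp add: minus_cd_def)

lemma scaleR_in [simp]: "a \<in> cd_alg n \<Longrightarrow> t *\<^sub>R a \<in> cd_alg n"
  by (induction n arbitrary: a) auto

lemma star_in [simp]: "a \<in> cd_alg n \<Longrightarrow> star a \<in> cd_alg n"
  by (induction n arbitrary: a) auto

lemma times_in [simp]: "a \<in> cd_alg n \<Longrightarrow> b \<in> cd_alg n \<Longrightarrow> a * b \<in> cd_alg n"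
  by (induction n arbitrary: a b) auto

lemma ii_in: "n \<ge> 1 \<Longrightarrow> ii n \<in> cd_alg n"
  by (cases n) (auto simp: ii_def)

lemma brace_in: "n \<ge> 1 \<Longrightarrow> a \<in> cd_alg n \<Longrightarrow> b \<in> cd_alg n \<Longrightarrow> brace n a b \<in> cd_alg (Suc n)"
  by (auto simp: brace_def ii_in)

lemma scaleR_zero_A: "r *\<^sub>R zero_A n = zero_A n"
  by (induction n) auto

lemma plus_uminus_cd: "a \<in> cd_alg n \<Longrightarrow> a + - a = zero_A n"
  by (induction n arbitrary: a) auto

lemma re_part_eq_scalar: "x \<in> cd_alg n \<Longrightarrow> \<exists>r. r *\<^sub>R one_A n = re_part x"
proof (induction n arbitrary: x)
  case 0
  then show ?case by (auto simp: re_part_def)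
next
  case (Suc n)
  then obtain a b where x: "x = CD a b" "a \<in> cd_alg n" "b \<in> cd_alg n" by auto
  from Suc.IH[OF x(2)] x show ?case
    by (auto simp: re_part_def scaleR_zero_A plus_uminus_cd)
qed

lemma scaleR_one_A_inject: "r *\<^sub>R one_A n = s *\<^sub>R one_A n \<longleftrightarrow> r = s"
  by (induction n) auto

lemma rinner_spec:
  assumes "a \<in> cd_alg n" "b \<in> cd_alg n"
  shows "rinner n a b *\<^sub>R one_A n = re_part (a * star b)"
proof -
  obtain r where r: "r *\<^sub>R one_A n = re_part (a * star b)"
    using re_part_eq_scalar assms by (metis star_in times_in)
  then show ?thesis
    by (simp add: rinner_def scaleR_one_A_inject flip: r)
qed

text \<open>The real coordinate of the unit, used only to show that \<open>orth_proj\<close> onto \<open>CC n\<close> is well defined.\<close>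

primrec coord :: "cd \<Rightarrow> real" where
  "coord (Scalar r) = r"
| "coord (CD a b) = coord a"

lemma coord_plus: "a \<in> cd_alg n \<Longrightarrow> b \<in> cd_alg n \<Longrightarrow> coord (a + b) = coord a + coord b"
  by (induction n arbitrary: a b) auto

lemma coord_uminus [simp]: "coord (- a) = - coord a"
  by (induction a) auto

lemma coord_minus: "a \<in> cd_alg n \<Longrightarrow> b \<in> cd_alg n \<Longrightarrow> coord (a - b) = coord a - coord b"
  by (simp add: minus_cd_def coord_plus)

lemma coord_scaleR [simp]: "coord (t *\<^sub>R a) = t * coord a"
  by (induction a) auto

lemma coord_star [simp]: "coord (star a) = coord a"
  by (induction a) auto

lemma coord_one_A [simp]: "coord (one_A n) = 1"
  by (induction n) auto

lemma rinner_eq_coord: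
  assumes "a \<in> cd_alg n" "b \<in> cd_alg n"
  shows "rinner n a b = coord (a * star b)"
proof -
  have "coord (rinner n a b *\<^sub>R one_A n) = coord (a * star b)"
    unfolding rinner_spec[OF assms] using assms
    by (simp add: re_part_def coord_plus[where n = n])
  then show ?thesis by simp
qed

lemma star_zero_A [simp]: "star (zero_A n) = zero_A n"
  and uminus_zero_A [simp]: "- zero_A n = zero_A n"
proof -
  show u: "- zero_A n = zero_A n" for n
    by (induction n) auto
  show "star (zero_A n) = zero_A n"
    by (induction n) (auto simp: u)
qed

lemma star_scaleR_one [simp]: "star (r *\<^sub>R one_A n) = r *\<^sub>R one_A n"
  by (induction n) (auto simp: scaleR_zero_A)

lemma uminus_scaleR: "- (r *\<^sub>R a) = (- r) *\<^sub>R (a :: cd)"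
  by (induction a) auto

lemma plus_zero_A [simp]: "a \<in> cd_alg n \<Longrightarrow> a + zero_A n = a"
  "a \<in> cd_alg n \<Longrightarrow> zero_A n + a = a"
  by (induction n arbitrary: a) auto

lemma minus_zero_A [simp]: "a \<in> cd_alg n \<Longrightarrow> a - zero_A n = a"
  by (simp add: minus_cd_def)

lemma times_zero_A [simp]: "a \<in> cd_alg n \<Longrightarrow> a * zero_A n = zero_A n"
  "a \<in> cd_alg n \<Longrightarrow> zero_A n * a = zero_A n"
  by (induction n arbitrary: a) auto

lemma times_scaleR_one [simp]: "a \<in> cd_alg n \<Longrightarrow> a * (r *\<^sub>R one_A n) = r *\<^sub>R a"
  "a \<in> cd_alg n \<Longrightarrow> (r *\<^sub>R one_A n) * a = r *\<^sub>R a"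
  by (induction n arbitrary: a) (auto simp: scaleR_zero_A)

lemma CC_Suc: "CC (Suc n) = {CD (r *\<^sub>R one_A n) (s *\<^sub>R one_A n) | r s. True}"
  by (simp add: CC_def ii_def scaleR_zero_A)

lemma rinner_CC:
  assumes "a \<in> cd_alg n" "b \<in> cd_alg n"
  shows "rinner (Suc n) (CD a b) (CD (r *\<^sub>R one_A n) (s *\<^sub>R one_A n)) = r * coord a + s * coord b"
  using assms
  by (subst rinner_eq_coord) (auto simp: coord_minus[where n = n] uminus_scaleR)

lemma orth_proj_CC_ex1:
  assumes "n \<ge> 1" "x \<in> cd_alg n"
  shows "\<exists>!p. p \<in> CC n \<and> x - p \<in> orth_compl n (CC n)"
proof -
  obtain m where n: "n = Suc m" using assms(1) by (cases n) auto
  obtain a b where x: "x = CD a b" "a \<in> cd_alg m" "b \<in> cd_alg m"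
    using assms(2) n by auto
  have *: "CD a b - CD (r *\<^sub>R one_A m) (s *\<^sub>R one_A m) \<in> orth_compl n (CC n)
      \<longleftrightarrow> r = coord a \<and> s = coord b" (is "?d \<in> _ \<longleftrightarrow> _") for r s
  proof -
    have d: "?d = CD (a - r *\<^sub>R one_A m) (b - s *\<^sub>R one_A m)"
      by (simp add: minus_cd_def)
    have "?d \<in> orth_compl n (CC n) \<longleftrightarrow> (\<forall>t u. t * (coord a - r) + u * (coord b - s) = 0)"
    proof -
      have "rinner (Suc m) (CD (a - r *\<^sub>R one_A m) (b - s *\<^sub>R one_A m))
          (CD (t *\<^sub>R one_A m) (u *\<^sub>R one_A m)) = t * (coord a - r) + u * (coord b - s)" for t u
        using x by (simp add: rinner_CC coord_minus[where n = m])
      then show ?thesis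
        using x unfolding d n orth_compl_def CC_Suc by simp metis
    qed
    also have "\<dots> \<longleftrightarrow> r = coord a \<and> s = coord b"
      by (auto dest: spec[of _ 1] spec[of _ 0])
         (metis add_0 diff_add_cancel mult_1 mult_zero_left add.right_neutral)+
    finally show ?thesis .
  qed
  show ?thesis
    unfolding x(1)
    by (rule ex1I[of _ "CD (coord a *\<^sub>R one_A m) (coord b *\<^sub>R one_A m)"])
       (use * in \<open>auto simp: n CC_Suc\<close>)
qed

end

theory Submission
  imports Defs
begin

text \<open>
  Write \<open>i = i\<^sub>n\<close>. If \<open>c\<close>, \<open>d\<close> and \<open>d c\<close> all lie in the orthogonal complement of \<open>\<complex>\<^sub>n\<close>, then
  \<open>(i c) (i d) = d c\<close> and \<open>(i c) d = i (d c)\<close>: for \<open>d = (p, q)\<close>, \<open>c = (r, s)\<close>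
  one has \<open>d c = (p r + s q, s p - q r)\<close>, and both
  identities say that the components of this pair are skew under conjugation. The
  hypotheses on \<open>a, b, x, y\<close> make this applicable to all combinations of \<open>a, b\<close> with
  combinations of \<open>x, y\<close>, and the claim follows by bilinearity, without any associativity.
\<close>

text \<open>
  Since addition on \<open>cd\<close> is not a group operation globally, linear identities are checked on
  the real entries, which are addressed by the path from the root.
\<close>

primrec entry :: "cd \<Rightarrow> bool list \<Rightarrow> real" where
  "entry (Scalar r) l = r"
| "entry (CD a b) l = (if hd l then entry a (tl l) else entry b (tl l))"

lemma entry_plus: "a \<in> cd_alg n \<Longrightarrow> b \<in> cd_alg n \<Longrightarrow> entry (a + b) l = entry a l + entry b l"
  by (induction n arbitrary: a b l) auto

lemma entry_uminus [simp]: "entry (- a) l = - entry a l"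
  by (induction a arbitrary: l) auto

lemma entry_minus: "a \<in> cd_alg n \<Longrightarrow> b \<in> cd_alg n \<Longrightarrow> entry (a - b) l = entry a l - entry b l"
  by (simp add: minus_cd_def entry_plus)

lemma entry_scaleR [simp]: "entry (t *\<^sub>R a) l = t * entry a l"
  by (induction a arbitrary: l) auto

text \<open>A tree of height \<open>n\<close> is determined by its leaves; the paths
  \<open>True # l\<close> and \<open>False # l\<close> lead into the two halves.\<close>

lemma cd_eqI:
  "a \<in> cd_alg n \<Longrightarrow> b \<in> cd_alg n \<Longrightarrow> (\<And>l. entry a l = entry b l) \<Longrightarrow> a = b"
proof (induction n arbitrary: a b)
  case (Suc n)
  then obtain p q r s where ab: "a = CD p q" "b = CD r s"
    and "p \<in> cd_alg n" "q \<in> cd_alg n" "r \<in> cd_alg n" "s \<in> cd_alg n"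
    by auto
  moreover have "entry p l = entry r l" for l
    using Suc.prems(3)[of "True # l"] ab by simp
  moreover have "entry q l = entry s l" for l
    using Suc.prems(3)[of "False # l"] ab by simp
  ultimately show ?case
    using Suc.IH by blast
qed auto

lemma uminus_uminus_cd [simp]: "- (- a) = (a :: cd)"
  by (induction a) auto

lemma scaleR_scaleR_cd [simp]: "s *\<^sub>R (t *\<^sub>R a) = (s * t) *\<^sub>R (a :: cd)"
  by (induction a) auto

lemma scaleR_one_cd [simp]: "1 *\<^sub>R a = (a :: cd)"
  by (induction a) auto

lemma star_star [simp]: "star (star a) = a"
  by (induction a) auto

lemma star_uminus [simp]: "star (- a) = - star a"
  by (induction a) auto

lemma scaleR_uminus_cd: "t *\<^sub>R (- a) = (- t) *\<^sub>R (a :: cd)"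
  by (induction a) auto

lemma star_scaleR [simp]: "star (t *\<^sub>R a) = t *\<^sub>R star a"
  by (induction a) (auto simp: uminus_scaleR scaleR_uminus_cd)

lemma uminus_plus_cd: "a \<in> cd_alg n \<Longrightarrow> b \<in> cd_alg n \<Longrightarrow> - (a + b) = - a + - (b :: cd)"
  by (rule cd_eqI[where n = n]) (auto simp: entry_plus[where n = n])

lemma star_plus: "a \<in> cd_alg n \<Longrightarrow> b \<in> cd_alg n \<Longrightarrow> star (a + b) = star a + star b"
  by (induction n arbitrary: a b) (auto simp: uminus_plus_cd)

text \<open>Both laws go into one induction: the product of pairs puts some factors on the opposite
  side (\<open>star d * b\<close>, \<open>d * a\<close>), so each law at height \<open>Suc n\<close>
  needs both at height \<open>n\<close>.\<close>

lemma distrib_cd: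
  assumes "a \<in> cd_alg n" "b \<in> cd_alg n" "c \<in> cd_alg n"
  shows "(a + b) * c = a * c + b * c" and "c * (a + b) = c * a + c * b"
proof -
  have "(a + b) * c = a * c + b * c \<and> c * (a + b) = c * a + c * b"
    using assms
  proof (induction n arbitrary: a b c)
    case 0
    then show ?case by (auto simp: algebra_simps)
  next
    case (Suc n)
    from Suc.prems show ?case
      by (auto simp: Suc.IH star_plus[where n = n] intro!: cd_eqI[where n = "Suc n"])
         (auto simp: entry_plus[where n = n] entry_minus[where n = n])
  qed
  then show "(a + b) * c = a * c + b * c" "c * (a + b) = c * a + c * b"
    by auto
qed

lemma times_scaleR_cd:
  assumes "a \<in> cd_alg n" "b \<in> cd_alg n"
  shows "(t *\<^sub>R a) * b = t *\<^sub>R (a * b)" and "a * (t *\<^sub>R b) = t *\<^sub>R (a * b)"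
proof -
  have "(t *\<^sub>R a) * b = t *\<^sub>R (a * b) \<and> a * (t *\<^sub>R b) = t *\<^sub>R (a * b)"
    using assms
  proof (induction n arbitrary: a b)
    case (Suc n)
    from Suc.prems show ?case
      by (auto simp: Suc.IH intro!: cd_eqI[where n = "Suc n"])
         (auto simp: entry_plus[where n = n] entry_minus[where n = n] algebra_simps)
  qed auto
  then show "(t *\<^sub>R a) * b = t *\<^sub>R (a * b)" "a * (t *\<^sub>R b) = t *\<^sub>R (a * b)"
    by auto
qed

lemma uminus_eq_scaleR: "- a = (- 1) *\<^sub>R (a :: cd)"
  by (induction a) auto

lemma times_uminus_cd:
  assumes "a \<in> cd_alg n" "b \<in> cd_alg n"
  shows "(- a) * b = - (a * b)" and "a * (- b) = - (a * b)"
  using assms by (simp_all add: uminus_eq_scaleR times_scaleR_cd)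

lemma star_times:
  assumes "a \<in> cd_alg n" "b \<in> cd_alg n"
  shows "star (a * b) = star b * star a"
  using assms
proof (induction n arbitrary: a b)
  case (Suc n)
  from Suc.prems show ?case
    by (auto simp: Suc.IH star_plus[where n = n] minus_cd_def times_uminus_cd[where n = n]
          intro!: cd_eqI[where n = "Suc n"])
       (auto simp: entry_plus[where n = n])
qed auto

text \<open>Conjugation negates every real entry except the coordinate of the unit.\<close>

lemma star_eq_uminus: "a \<in> cd_alg n \<Longrightarrow> coord a = 0 \<Longrightarrow> star a = - a"
  by (induction n arbitrary: a) auto

text \<open>The inner product with \<open>(r, s)\<close> is
  \<open>r * coord p + s * coord q\<close>; testing \<open>r\<close>, \<open>s\<close> at 0 and 1
  separates the two real parts.\<close>

lemma CC_perp_Suc: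
  "CC_perp (Suc m) = {CD p q | p q. p \<in> cd_alg m \<and> q \<in> cd_alg m \<and> coord p = 0 \<and> coord q = 0}"
proof -
  have "CD p q \<in> CC_perp (Suc m) \<longleftrightarrow> coord p = 0 \<and> coord q = 0"
    if "p \<in> cd_alg m" "q \<in> cd_alg m" for p q
  proof -
    have "CD p q \<in> CC_perp (Suc m) \<longleftrightarrow> (\<forall>r s. r * coord p + s * coord q = 0)"
      unfolding CC_perp_def orth_compl_def CC_Suc
      using that by (simp flip: rinner_CC[OF that]) blast
    then show ?thesis
      by (metis add.right_neutral add_0 mult_1 mult_zero_left mult_zero_right)
  qed
  moreover have "CC_perp (Suc m) \<subseteq> cd_alg (Suc m)"
    by (auto simp: CC_perp_def orth_compl_def)
  ultimately show ?thesis
    by fastforce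
qed

lemma CC_perp_in: "a \<in> CC_perp n \<Longrightarrow> a \<in> cd_alg n"
  by (simp add: CC_perp_def orth_compl_def)

lemma CC_perp_plus:
  "n \<ge> 1 \<Longrightarrow> a \<in> CC_perp n \<Longrightarrow> b \<in> CC_perp n \<Longrightarrow> a + b \<in> CC_perp n"
  by (cases n) (auto simp: CC_perp_Suc coord_plus)

lemma CC_perp_uminus: "n \<ge> 1 \<Longrightarrow> a \<in> CC_perp n \<Longrightarrow> - a \<in> CC_perp n"
  by (cases n) (auto simp: CC_perp_Suc)

lemma star_CC_perp: "n \<ge> 1 \<Longrightarrow> a \<in> CC_perp n \<Longrightarrow> star a = - a"
  by (cases n) (auto simp: CC_perp_Suc star_eq_uminus)

text \<open>The projection of \<open>a * star x\<close> is zero, so this product is its own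
  component orthogonal to \<open>CC n\<close>; and \<open>star x = - x\<close>.\<close>

lemma C_orthogonal_times:
  assumes "n \<ge> 1" "a \<in> CC_perp n" "x \<in> CC_perp n" "C_orthogonal n a x"
  shows "a * x \<in> CC_perp n"
proof -
  note in_alg = CC_perp_in[OF assms(2)] CC_perp_in[OF assms(3)]
  have "a * star x - hinner n a x \<in> CC_perp n"
    unfolding hinner_def orth_proj_def CC_perp_def
    using theI'[OF orth_proj_CC_ex1[OF assms(1), of "a * star x"]] in_alg by simp
  then have "- (a * x) \<in> CC_perp n"
    using assms in_alg by (simp add: C_orthogonal_def star_CC_perp times_uminus_cd)
  then show ?thesis
    using CC_perp_uminus[OF assms(1)] by fastforce
qed

lemma ii_times:
  "p \<in> cd_alg m \<Longrightarrow> q \<in> cd_alg m \<Longrightarrow> ii (Suc m) * CD p q = CD (- star q) (star p)"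
  \<comment> \<open>At scalar 1 this is the unit law for \<open>one_A m\<close>.\<close>
  using times_scaleR_one[of _ m 1] by (simp add: ii_def minus_cd_def)

lemma CC_perp_ii_times: "n \<ge> 1 \<Longrightarrow> a \<in> CC_perp n \<Longrightarrow> ii n * a \<in> CC_perp n"
  by (cases n) (auto simp: CC_perp_Suc ii_times)

lemma ii_times_products:
  assumes "n \<ge> 1" "c \<in> CC_perp n" "d \<in> CC_perp n" "d * c \<in> CC_perp n"
  shows "(ii n * c) * (ii n * d) = d * c" and "(ii n * c) * d = ii n * (d * c)"
proof -
  obtain m where n: "n = Suc m" using assms(1) by (cases n) auto
  obtain p q where d: "d = CD p q" and pq: "p \<in> cd_alg m" "q \<in> cd_alg m" "coord p = 0" "coord q = 0"
    using assms(3) unfolding n CC_perp_Suc by auto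
  obtain r s where c: "c = CD r s" and rs: "r \<in> cd_alg m" "s \<in> cd_alg m" "coord r = 0" "coord s = 0"
    using assms(2) unfolding n CC_perp_Suc by auto
  note st = pq(1,2) rs(1,2) star_eq_uminus[OF pq(1,3)] star_eq_uminus[OF pq(2,4)]
    star_eq_uminus[OF rs(1,3)] star_eq_uminus[OF rs(2,4)]
  note ring = times_uminus_cd[where n = m] minus_cd_def
  \<comment> \<open>All four components are imaginary, so the conjugations in the product become
    signs.\<close>
  have dc: "d * c = CD (p * r + s * q) (s * p + - (q * r))"
    using st by (simp add: d c ring)
  have "coord (p * r + s * q) = 0" "coord (s * p + - (q * r)) = 0"
    using assms(4) unfolding dc n CC_perp_Suc by auto
  then have "star (p * r + s * q) = - (p * r + s * q)"
    "star (s * p + - (q * r)) = - (s * p + - (q * r))"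
    using st by (auto intro!: star_eq_uminus[where n = m])
  \<comment> \<open>Conjugation reverses each product, and the two signs of its imaginary factors
    cancel.\<close>
  then have skew: "r * p + q * s = - (p * r + s * q)" "p * s + - (r * q) = - (s * p + - (q * r))"
    using st by (simp_all add: star_plus[where n = m] star_times[where n = m] ring)
  have skew_entry: "entry (r * p) l + entry (q * s) l = - (entry (p * r) l + entry (s * q) l)"
    "entry (p * s) l - entry (r * q) l = - (entry (s * p) l - entry (q * r) l)" for l
    using arg_cong[OF skew(1), of "\<lambda>z. entry z l"] arg_cong[OF skew(2), of "\<lambda>z. entry z l"] st
    by (simp_all add: entry_plus[where n = m])
  have ic: "ii n * c = CD s (- r)" and id: "ii n * d = CD q (- p)"
    using st by (simp_all add: n c d ii_times)
  \<comment> \<open>These are the components of \<open>(ii n * c) * (ii n * d)\<close>: the first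
    only reorders summands, the second is the second skew relation.\<close>
  have "s * q + p * r = p * r + s * q" "- (p * s) + r * q = s * p + - (q * r)"
    using st skew_entry by (auto intro!: cd_eqI[where n = m] simp: entry_plus[where n = m] algebra_simps)
  then show "(ii n * c) * (ii n * d) = d * c"
    using st by (simp add: ic id dc ring)
  have "s * p + - (q * r) = - star (s * p + - (q * r))" "q * s + r * p = star (p * r + s * q)"
    using st skew_entry
    by (auto intro!: cd_eqI[where n = m]
        simp: entry_plus[where n = m] star_plus[where n = m] star_times[where n = m] ring algebra_simps)
  then show "(ii n * c) * d = ii n * (d * c)"
    using st unfolding ic dc unfolding n by (simp add: ii_times d ring)
qed

theorem proposition1p2:
  fixes n :: nat and a b x y :: cd
  assumes "n \<ge> 1"
    and "a \<in> CC_perp n" and "b \<in> CC_perp n"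
    and "x \<in> CC_perp n" and "y \<in> CC_perp n"
    and "C_orthogonal n a x" and "C_orthogonal n a y"
    and "C_orthogonal n b x" and "C_orthogonal n b y"
  shows "brace n a b * brace n x y = sqrt 2 *\<^sub>R brace n (a * x) (b * y)"
proof -
  note n = assms(1)
  note perp = CC_perp_plus[OF n] CC_perp_uminus[OF n] C_orthogonal_times[OF n]
  note in_alg = assms(2-5)[THEN CC_perp_in] ii_in[OF n]
  note linear = distrib_cd[where n = n] times_uminus_cd[where n = n] uminus_plus_cd[where n = n]
  \<comment> \<open>Up to the factor \<open>1 / sqrt 2\<close>, the braces to be multiplied are
    \<open>(S, i D)\<close> and \<open>(X, i Y)\<close>.\<close>
  define S D X Y where defs: "S = a + b" "D = - a + b" "X = x + y" "Y = - x + y"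
  have P: "S \<in> CC_perp n" "D \<in> CC_perp n" "X \<in> CC_perp n" "Y \<in> CC_perp n"
    using assms by (auto simp: defs intro: perp)
  note PA = P[THEN CC_perp_in]
  \<comment> \<open>Each product expands into signed copies of \<open>a * x\<close>,
    \<open>a * y\<close>, \<open>b * x\<close>, \<open>b * y\<close>, all in the complement by
    C-orthogonality.\<close>
  have prod: "S * Y \<in> CC_perp n" "D * Y \<in> CC_perp n" "D * X \<in> CC_perp n"
    using assms in_alg by (auto simp: defs linear intro!: perp)
  \<comment> \<open>\<open>X\<close>, \<open>D\<close> and \<open>D * X\<close> are all skew, so
    conjugating \<open>D * X\<close> gives both \<open>X * D\<close> and
    \<open>- (D * X)\<close>.\<close>
  have XD: "X * D = - (D * X)"
    using star_times[OF PA(2,3)] P prod PA n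
    by (simp add: star_CC_perp times_uminus_cd[where n = n])
  \<comment> \<open>Here \<open>star (ii n * Y) = - (ii n * Y)\<close>, and the first product
    identity applies with \<open>c = Y\<close>, \<open>d = D\<close>.\<close>
  have "S * X - star (ii n * Y) * (ii n * D) = S * X + D * Y"
    using n P PA prod in_alg
    by (simp add: star_CC_perp CC_perp_ii_times times_uminus_cd[where n = n] minus_cd_def
        ii_times_products)
  \<comment> \<open>The mixed terms \<open>a * y\<close> and \<open>b * x\<close> cancel.\<close>
  also have "\<dots> = 2 *\<^sub>R (a * x + b * y)"
    using in_alg by (auto simp: defs linear intro!: cd_eqI[where n = n])
      (auto simp: entry_plus[where n = n])
  finally have fst: "S * X - star (ii n * Y) * (ii n * D) = 2 *\<^sub>R (a * x + b * y)" .
  have "(ii n * D) * X = ii n * (X * D)"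
    using ii_times_products(2)[OF n P(2,3)] prod XD perp(2) by simp
  \<comment> \<open>The sign from \<open>star X = - X\<close> cancels the one from
    \<open>XD\<close>.\<close>
  then have "(ii n * Y) * S + (ii n * D) * star X = ii n * (S * Y) + ii n * (D * X)"
    using n P PA prod in_alg
    by (simp add: star_CC_perp times_uminus_cd[where n = n] ii_times_products XD)
  also have "\<dots> = ii n * (2 *\<^sub>R (- (a * x) + b * y))"
    unfolding distrib_cd(2)[OF times_in[OF PA(1,4)] times_in[OF PA(2,3)] in_alg(5), symmetric]
    using in_alg by (intro arg_cong[where f = "\<lambda>z. ii n * z"])
      (auto simp: defs linear entry_plus[where n = n] intro!: cd_eqI[where n = n])
  also have "\<dots> = 2 *\<^sub>R (ii n * (- (a * x) + b * y))"
    using in_alg by (simp add: times_scaleR_cd[where n = n])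
  finally have snd: "(ii n * Y) * S + (ii n * D) * star X = 2 *\<^sub>R (ii n * (- (a * x) + b * y))" .
  \<comment> \<open>The two normalizing factors \<open>1 / sqrt 2\<close> combine to
    \<open>1/2\<close>, which absorbs the 2 in \<open>fst\<close> and \<open>snd\<close>.\<close>
  have "brace n a b * brace n x y = (1/2) *\<^sub>R (CD S (ii n * D) * CD X (ii n * Y))"
    using in_alg PA unfolding brace_def defs[symmetric]
    by (subst times_scaleR_cd[where n = "Suc n"], simp, simp del: scaleR_cd.simps times_cd.simps)
       (subst times_scaleR_cd[where n = "Suc n"], auto simp del: times_cd.simps simp: uminus_scaleR)
  also have "\<dots> = CD (a * x + b * y) (ii n * (- (a * x) + b * y))"
    by (simp add: fst snd)
  also have "\<dots> = sqrt 2 *\<^sub>R brace n (a * x) (b * y)"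
    by (simp add: brace_def)
  finally show ?thesis .
qed

end
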